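(* Let $k$ be a field of characteristic not equal to $2$ and let $L$ be a finite-dimensional nilpotent Lie algebra over $k$ such that $\dim L' \leq 3$. Then $w(L)=L'$.
   Context: For a Lie algebra $L$ over $k$, $L'=[L,L]$ denotes the derived subalgebra, i.e. the linear span of all brackets $[x,y]$ with $x,y\in L$. A nonzero multilinear Lie polynomial of degree $2$ over $k$ is $w(x,y)=c[x,y]$ with $0\neq c\in k$, and $w(L)=\{w(x,y): x,y\in L\}$ denotes its image on $L$; equivalently $w(L)=\{[x,y]: x,y\in L\}$ (independent of $c$). *)

theory Defs
  imports Complex_Main
begin

locale lie_algebra = vector_space scale
  for scale :: "'k::field \<Rightarrow> 'l::ab_group_add \<Rightarrow> 'l" (infixr \<open>*s\<close> 75) +
  fixes bracket :: "'l \<Rightarrow> 'l \<Rightarrow> 'l"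
  assumes bracket_linear_right: "Vector_Spaces.linear scale scale (\<lambda>y. bracket x y)"
    and bracket_linear_left: "Vector_Spaces.linear scale scale (\<lambda>x. bracket x y)"
    and bracket_self: "bracket x x = 0"
    and jacobi: "bracket x (bracket y z) + bracket y (bracket z x) + bracket z (bracket x y) = 0"
begin

definition bracket_span :: "'l set \<Rightarrow> 'l set \<Rightarrow> 'l set" where
  "bracket_span A B = span {bracket x y | x y. x \<in> A \<and> y \<in> B}"

definition derived :: "'l set" where
  "derived = bracket_span UNIV UNIV"

primrec lower_central :: "nat \<Rightarrow> 'l set" where
  "lower_central 0 = UNIV"
| "lower_central (Suc n) = bracket_span UNIV (lower_central n)"

definition nilpotent :: bool where
  "nilpotent \<longleftrightarrow> (\<exists>n. lower_central n = {0})"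

text \<open>By anticommutativity, every multilinear Lie polynomial of degree 2 has the form
  \<open>c [x, y]\<close>; it is nonzero iff \<open>c \<noteq> 0\<close>.\<close>

definition lie_poly2 :: "'k \<Rightarrow> 'l \<Rightarrow> 'l \<Rightarrow> 'l" where
  "lie_poly2 c x y = c *s bracket x y"

end

definition poly_image :: "('l \<Rightarrow> 'l \<Rightarrow> 'l) \<Rightarrow> 'l set" where
  "poly_image w = {w x y | x y. True}"

end

theory Submission
  imports Defs
begin

text \<open>
  The statement is a fact about alternating bilinear maps: if \<open>B\<close> is one and its values span a space
  \<open>D\<close> of dimension at most 3, then every element of \<open>D\<close> is a value of \<open>B\<close>. The Lie bracket is such
  a map.

  Suppose first that some \<open>x\<close>, \<open>y\<close>, \<open>w\<close> have linearly independent values \<open>B x y\<close>, \<open>B x w\<close>, \<open>B y w\<close>.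
  Then these three are a basis of \<open>D\<close>, and every combination of them is a value of \<open>B\<close>, because every
  bivector in a space of dimension 3 is decomposable (\<open>combination_is_value\<close>).

  Otherwise the values of \<open>B\<close> on any three vectors are dependent, and this already forces \<open>D\<close> to be
  the set of values \<open>B x y\<close> for a single \<open>x\<close>. If some partial map \<open>B x\<close> has rank at least 2, dependence
  gives \<open>B a b \<in> range (B x)\<close> for all \<open>a\<close>, \<open>b\<close> with \<open>B x a\<close> and \<open>B x b\<close> independent; such pairs are so
  plentiful that bilinearity extends this to all \<open>a\<close> and \<open>b\<close> (\<open>values_in_range_if_rank_ge_2\<close>). If all
  partial maps have rank at most 1, then all values lie on one line (\<open>values_on_line_if_ranks_le_1\<close>).
\<close>

locale alternating_bilinear_map =
  V: vector_space scaleV + W: vector_space scaleW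
  for scaleV :: "'k::field \<Rightarrow> 'v::ab_group_add \<Rightarrow> 'v" (infixr \<open>*v\<close> 75)
    and scaleW :: "'k \<Rightarrow> 'w::ab_group_add \<Rightarrow> 'w" (infixr \<open>*w\<close> 75) +
  fixes B :: "'v \<Rightarrow> 'v \<Rightarrow> 'w"
  assumes linear_right: "Vector_Spaces.linear scaleV scaleW (B x)"
    and linear_left: "Vector_Spaces.linear scaleV scaleW (\<lambda>x. B x y)"
    and alternating: "B x x = 0"
begin

lemma add_right: "B x (y + z) = B x y + B x z"
  using linear_right by (simp add: Vector_Spaces.linear_iff)

lemma add_left: "B (x + y) z = B x z + B y z"
  using linear_left by (simp add: Vector_Spaces.linear_iff)

lemma scale_right: "B x (c *v y) = c *w B x y"
  using linear_right by (simp add: Vector_Spaces.linear_iff)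

lemma scale_left: "B (c *v x) y = c *w B x y"
  using linear_left by (simp add: Vector_Spaces.linear_iff)

lemma diff_right: "B x (y - z) = B x y - B x z"
  using add_right[of x "y - z" z] by (simp add: algebra_simps)

lemma diff_left: "B (x - y) z = B x z - B y z"
  using add_left[of "x - y" y z] by (simp add: algebra_simps)

lemma swap: "B y x = - B x y"
proof -
  have "B (x + y) (x + y) = B y x + B x y"
    unfolding add_left add_right by (simp add: alternating add.commute)
  then show ?thesis
    by (simp add: alternating eq_neg_iff_add_eq_0)
qed

lemma subspace_range: "W.subspace (range (B x))"
proof (rule W.subspaceI)
  show "0 \<in> range (B x)"
    using alternating[of x] by (metis rangeI)
  show "p + q \<in> range (B x)" if "p \<in> range (B x)" "q \<in> range (B x)" for p q
    using that by (auto simp flip: add_right)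
  show "c *w p \<in> range (B x)" if "p \<in> range (B x)" for c p
    using that by (auto simp flip: scale_right)
qed

lemma span_values_subset:
  assumes "W.subspace S" and "\<And>a b. B a b \<in> S"
  shows "W.span {B a b | a b. True} \<subseteq> S"
  using assms by (intro W.span_minimal) auto

text \<open>The combination below is the image of a bivector in the span of \<open>x\<close>, \<open>y\<close>, \<open>w\<close>, and
  each bivector in a space of dimension 3 is of the form \<open>a \<and> b\<close>.\<close>
lemma combination_is_value:
  "\<exists>a b. \<alpha> *w B x y + \<beta> *w B x w + \<gamma> *w B y w = B a b"
proof (cases "\<alpha> = 0")
  case True
  then have "\<alpha> *w B x y + \<beta> *w B x w + \<gamma> *w B y w = B (\<beta> *v x + \<gamma> *v y) w"
    by (simp add: add_left scale_left)
  then show ?thesis by blast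
next
  case False
  then have "\<alpha> *w B x y + \<beta> *w B x w + \<gamma> *w B y w
      = B (x - (\<gamma> / \<alpha>) *v w) (\<alpha> *v y + \<beta> *v w)"
    by (simp add: diff_left add_right scale_left scale_right alternating swap[of w y]
        W.scale_right_distrib)
  then show ?thesis by blast
qed

lemma value_if_in_span_3:
  assumes "z \<in> W.span {B x y, B x w, B y w}"
  shows "\<exists>a b. z = B a b"
proof -
  obtain \<alpha> \<beta> \<gamma> where "z - \<alpha> *w B x y - \<beta> *w B x w = \<gamma> *w B y w"
    using assms by (auto simp: W.span_breakdown_eq)
  then have "z = \<alpha> *w B x y + \<beta> *w B x w + \<gamma> *w B y w"
    by (simp add: algebra_simps)
  then show ?thesis
    using combination_is_value by metis
qed

text \<open>The assumption on triples puts \<open>B a b\<close> into the range of \<open>B x\<close> whenever \<open>B x a\<close> and \<open>B x b\<close> are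
  independent. Modulo this range \<open>B\<close> is again alternating bilinear, so it suffices to show that the
  kernel of \<open>B x\<close> is in its radical: if \<open>B x b\<close> is a multiple of \<open>B x a\<close>, then \<open>b\<close> is a multiple of
  \<open>a\<close> up to this kernel. The rank condition enters through the kernel: it provides, for each \<open>b\<close>
  outside, a vector whose image is independent of \<open>B x b\<close>.\<close>
lemma values_in_range_if_rank_ge_2:
  assumes triples_dependent: "\<And>a b. B x a \<noteq> 0 \<Longrightarrow> B x b \<notin> W.span {B x a} \<Longrightarrow>
      B a b \<in> W.span {B x a, B x b}"
    and "B x y \<noteq> 0" and "B x w \<notin> W.span {B x y}"
  shows "B a b \<in> range (B x)"
proof -
  let ?P = "range (B x)"
  have diff_in: "p - q \<in> ?P" if "p \<in> ?P" "q \<in> ?P" for p q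
    using that subspace_range by (rule W.subspace_diff[rotated 1])
  have neg_in: "- p \<in> ?P" if "p \<in> ?P" for p
    using that subspace_range by (rule W.subspace_neg[rotated 1])
  have independent_case: "B a b \<in> ?P"
    if "B x a \<noteq> 0" "B x b \<notin> W.span {B x a}" for a b
  proof -
    have "W.span {B x a, B x b} \<subseteq> ?P"
      using subspace_range by (intro W.span_minimal) auto
    then show ?thesis using triples_dependent[OF that] by blast
  qed
  \<comment> \<open>A vector \<open>k\<close> in the kernel of \<open>B x\<close> is the difference of \<open>k + e\<close> and \<open>e\<close>, which have the same
    image under \<open>B x\<close>; choosing this image independent of \<open>B x b\<close> reduces to the previous case.\<close>
  have kernel_left: "B k b \<in> ?P" if k: "B x k = 0" and b: "B x b \<noteq> 0" for k b
  proof -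
    obtain e where e: "B x e \<notin> W.span {B x b}"
    proof (cases "B x y \<in> W.span {B x b}")
      case True
      then obtain s where s: "B x y = s *w B x b"
        by (auto simp: W.span_singleton)
      with \<open>B x y \<noteq> 0\<close> have "B x b = (1 / s) *w B x y" by auto
      then have "B x b \<in> W.span {B x y}"
        by (metis W.span_base W.span_scale singletonI)
      then have "W.span {B x b} \<subseteq> W.span {B x y}"
        by (intro W.span_minimal) auto
      then show ?thesis using assms(3) that by blast
    qed (rule that)
    have "B b (k + e) \<in> ?P" and "B b e \<in> ?P"
      by (rule independent_case; use b e k in \<open>simp add: add_right\<close>)+
    from diff_in[OF this] have "B b k \<in> ?P"
      by (simp add: add_right)
    then show ?thesis using neg_in swap by metis
  qed
  have kernel: "B k b \<in> ?P" if k: "B x k = 0" for k b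
  proof (cases "B x b = 0")
    case True
    have "B k (b + y) \<in> ?P" "B k y \<in> ?P"
      by (rule kernel_left; use True k \<open>B x y \<noteq> 0\<close> in \<open>simp add: add_right\<close>)+
    from diff_in[OF this] show ?thesis
      by (simp add: add_right)
  qed (use k kernel_left in blast)
  show ?thesis
  proof (cases "B x a = 0")
    case False
    show ?thesis
    proof (cases "B x b \<in> W.span {B x a}")
      case True
      then obtain s where s: "B x b = s *w B x a"
        by (auto simp: W.span_singleton)
      \<comment> \<open>Now \<open>b - s a\<close> is in the kernel of \<open>B x\<close>, and subtracting \<open>s a\<close> leaves \<open>B a b\<close> unchanged.\<close>
      then have "B (b - s *v a) a \<in> ?P"
        by (intro kernel) (simp add: diff_right scale_right)
      then have "B a (b - s *v a) \<in> ?P"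
        using neg_in swap by metis
      then show ?thesis
        by (simp add: diff_right scale_right alternating)
    qed (use False independent_case in blast)
  qed (use kernel in blast)
qed

text \<open>A partial map of rank at most 1 that has one nonzero value on the line through \<open>B x y\<close> has all
  its values there. This passes the line from \<open>x\<close> to \<open>y\<close> and on to every \<open>a\<close> that does not vanish
  against both.\<close>
lemma values_on_line_if_ranks_le_1:
  assumes rank_le_1: "\<And>x y w. B x y \<noteq> 0 \<Longrightarrow> B x w \<in> W.span {B x y}"
    and xy: "B x y \<noteq> 0"
  shows "B a b \<in> W.span {B x y}"
proof -
  let ?S = "W.span {B x y}"
  have through: "B a b \<in> ?S" if "B a e \<in> ?S" "B a e \<noteq> 0" for a b e
  proof -
    have "W.span {B a e} \<subseteq> ?S"
      using that by (intro W.span_minimal) auto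
    then show ?thesis using rank_le_1[OF that(2)] by blast
  qed
  have x: "B x b \<in> ?S" for b
    using rank_le_1[OF xy] .
  have y_line: "B y b \<in> ?S" for b
    using through[of y x b] xy by (simp add: swap[of y x] W.span_neg W.span_base)
  show ?thesis
  proof (cases "B a x = 0 \<and> B a y = 0")
    case True
    \<comment> \<open>Here \<open>a\<close> need not have a nonzero value on the line, but \<open>a + x\<close> has the value \<open>B x y\<close>.\<close>
    then have "B (a + x) y = B x y" by (simp add: add_left)
    then have "B (a + x) b \<in> ?S"
      using through[of "a + x" y b] xy by (simp add: W.span_base)
    then have "B (a + x) b - B x b \<in> ?S"
      using x by (rule W.span_diff)
    then show ?thesis by (simp add: add_left)
  next
    case False
    moreover have "B a x \<in> ?S" "B a y \<in> ?S"
      using x[of a] y_line[of a] by (simp_all add: swap[of a] W.span_neg)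
    ultimately show ?thesis using through by blast
  qed
qed

theorem span_values_eq_values:
  assumes fin: "finite_dimensional_vector_space scaleW Basis"
    and dim: "W.dim (W.span {B x y | x y. True}) \<le> 3"
  shows "W.span {B x y | x y. True} = {B x y | x y. True}" (is "?D = ?I")
proof
  show "?I \<subseteq> ?D" by (rule W.span_superset)
  have value_in: "B x y \<in> ?D" for x y
    by (rule W.span_base) blast
  consider
    (triple) x y w where "B x y \<noteq> 0" "B x w \<notin> W.span {B x y}" "B y w \<notin> W.span {B x y, B x w}"
  | (rank_ge_2) x y w where "B x y \<noteq> 0" "B x w \<notin> W.span {B x y}"
      "\<And>a b. B x a \<noteq> 0 \<Longrightarrow> B x b \<notin> W.span {B x a} \<Longrightarrow> B a b \<in> W.span {B x a, B x b}"
  | (ranks_le_1) "\<And>x y w. B x y \<noteq> 0 \<Longrightarrow> B x w \<in> W.span {B x y}"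
    by metis
  then show "?D \<subseteq> ?I"
  proof cases
    case triple
    interpret W: finite_dimensional_vector_space scaleW Basis by (rule fin)
    let ?T = "{B y w, B x w, B x y}"
    have "W.independent ?T"
      using triple by (intro W.independent_insertI) (auto simp: insert_commute W.independent_empty)
    moreover have "card ?T = 3"
    proof -
      have "B x w \<noteq> B x y" "B y w \<notin> {B x y, B x w}"
        using triple(2,3) by (auto simp: W.span_base)
      then show ?thesis by auto
    qed
    moreover have "?T \<subseteq> ?D"
      using value_in by simp
    ultimately have "?D \<subseteq> W.span ?T"
      using dim by (intro W.card_ge_dim_independent[of ?T ?D]) simp_all
    also have "?T = {B x y, B x w, B y w}" by auto
    finally have D: "?D \<subseteq> W.span {B x y, B x w, B y w}" .
    show ?thesis
    proof
      fix z assume "z \<in> ?D"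
      with D have "z \<in> W.span {B x y, B x w, B y w}" by (rule subsetD)
      then show "z \<in> ?I" using value_if_in_span_3 by simp
    qed
  next
    case rank_ge_2
    then have "?D \<subseteq> range (B x)"
      by (intro span_values_subset subspace_range values_in_range_if_rank_ge_2) auto
    then show ?thesis by blast
  next
    case ranks_le_1
    show ?thesis
    proof (cases "\<exists>x y. B x y \<noteq> 0")
      case True
      then obtain x y where xy: "B x y \<noteq> 0" by blast
      have "?D \<subseteq> W.span {B x y}"
        by (intro span_values_subset W.subspace_span values_on_line_if_ranks_le_1[OF ranks_le_1 xy])
      also have "\<dots> \<subseteq> range (B x)"
        using subspace_range by (intro W.span_minimal) auto
      finally show ?thesis by blast
    next
      case False
      then have "B a b \<in> range (B 0)" for a b
        using W.subspace_0[OF subspace_range] by simp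
      then have "?D \<subseteq> range (B 0)"
        by (intro span_values_subset subspace_range)
      then show ?thesis by blast
    qed
  qed
qed

end

theorem theorem1:
  fixes scale :: "'k::field \<Rightarrow> 'l::ab_group_add \<Rightarrow> 'l"
    and bracket :: "'l \<Rightarrow> 'l \<Rightarrow> 'l"
    and Basis :: "'l set"
    and c :: 'k
  assumes "CHAR('k) \<noteq> 2"
    and "lie_algebra scale bracket"
    and "finite_dimensional_vector_space scale Basis"
    and "lie_algebra.nilpotent scale bracket"
    and "vector_space.dim scale (lie_algebra.derived scale bracket) \<le> 3"
    and "c \<noteq> 0"
  shows "poly_image (lie_algebra.lie_poly2 scale bracket c) = lie_algebra.derived scale bracket"
proof -
  interpret L: lie_algebra scale bracket by fact
  interpret A: alternating_bilinear_map scale scale bracket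
    by unfold_locales
      (use L.bracket_linear_left L.bracket_linear_right in
      \<open>simp_all add: Vector_Spaces.linear_iff L.bracket_self\<close>)
  have derived: "L.derived = L.span {bracket x y | x y. True}"
    by (simp add: L.derived_def L.bracket_span_def)
  have "L.derived = {bracket x y | x y. True}"
    using A.span_values_eq_values[OF assms(3)] assms(5) by (simp add: derived)
  also have "\<dots> = poly_image (L.lie_poly2 c)"
  proof -
    have "bracket x y = scale c (bracket (scale (1 / c) x) y)" for x y
      using \<open>c \<noteq> 0\<close> by (simp add: A.scale_left)
    moreover have "scale c (bracket x y) = bracket (scale c x) y" for x y
      by (simp add: A.scale_left)
    ultimately show ?thesis
      unfolding poly_image_def L.lie_poly2_def by blast
  qed
  finally show ?thesis by simp
qed

end
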